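(* For every integer $n\ge1$, the number of permutations $\pi$ of length $n$ such that the occurrence graph $G_{12}(\pi)$ is a tree equals $(n-1)^2$.
   Context: For a permutation $\pi$ of length $n$, $V_{12}(\pi)$ is the set of pairs $\{i,j\}$ with $1\le i<j\le n$ and $\pi(i)<\pi(j)$, and the occurrence graph $G_{12}(\pi)$ is the simple undirected graph with vertex set $V_{12}(\pi)$ in which two vertices are adjacent iff they share exactly one element. A tree is a graph with at least one vertex that is connected and has no cycles (the graph with no vertices is not a tree). *)

theory Defs
  imports "HOL-Combinatorics.Permutations" "Graph_Theory.Digraph_Component"
begin

definition V12 :: "nat \<Rightarrow> (nat \<Rightarrow> nat) \<Rightarrow> nat set set" where
  "V12 n \<pi> = {{i, j} | i j. 1 \<le> i \<and> i < j \<and> j \<le> n \<and> \<pi> i < \<pi> j}"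

text \<open>
  A simple undirected graph is represented as a symmetric loop-free digraph without parallel arcs
  (the locale \<^locale>\<open>pair_graph\<close>), each undirected edge being a pair of opposite arcs.
\<close>

definition G12 :: "nat \<Rightarrow> (nat \<Rightarrow> nat) \<Rightarrow> nat set pair_pre_digraph" where
  "G12 n \<pi> = \<lparr>pverts = V12 n \<pi>,
     parcs = {(u, v). u \<in> V12 n \<pi> \<and> v \<in> V12 n \<pi> \<and> card (u \<inter> v) = 1}\<rparr>"

lemma finite_V12: "finite (V12 n \<pi>)"
  by (rule finite_subset[of _ "Pow {1..n}"]) (auto simp: V12_def)

lemma pair_graph_G12: "pair_graph (G12 n \<pi>)"
proof
  show "finite (pverts (G12 n \<pi>))"
    by (simp add: G12_def finite_V12)
  show "finite (parcs (G12 n \<pi>))"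
    by (rule finite_subset[of _ "V12 n \<pi> \<times> V12 n \<pi>"]) (auto simp: G12_def finite_V12)
  show "symmetric (with_proj (G12 n \<pi>))"
    by (auto simp: symmetric_def sym_def G12_def Int_commute)
  show "fst e \<noteq> snd e" if "e \<in> parcs (G12 n \<pi>)" for e
    using that by (auto simp: G12_def V12_def)
qed (auto simp: G12_def)

text \<open>
  The library predicate \<^const>\<open>tree\<close> is not usable here: it forbids every directed cycle, and in
  a symmetric digraph each undirected edge already gives a directed cycle of length 2. A cycle
  of a simple undirected graph is a directed cycle of length at least 3 in its symmetric digraph.
  The library's \<^const>\<open>Digraph_Component.connected\<close> requires a nonempty vertex set.
\<close>

definition undirected_cycle :: "'a pair_pre_digraph \<Rightarrow> ('a \<times> 'a) awalk \<Rightarrow> bool" where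
  "undirected_cycle G p \<longleftrightarrow> pre_digraph.cycle (with_proj G) p \<and> 3 \<le> length p"

definition undirected_tree :: "'a pair_pre_digraph \<Rightarrow> bool" where
  "undirected_tree G \<longleftrightarrow>
     pair_graph G \<and> Digraph_Component.connected (with_proj G) \<and> (\<nexists>p. undirected_cycle G p)"

end

theory Submission
  imports Defs
begin

text \<open>
  Reversing the values turns \<open>\<pi>\<close> into a permutation \<open>\<sigma>\<close> for which the vertices are the inversions,
  so the occurrence graph is the line graph of the inversion graph of \<open>\<sigma>\<close>, and it is a tree iff that
  inversion graph is a path plus isolated points. Since 4-cycles are excluded, at most one point
  crosses each cut between \<open>c\<close> and \<open>c + 1\<close> in either direction; by connectedness the crossed cuts form
  an interval \<open>a \<le> c \<le> b\<close>, and since patterns 321 and points with three inversions are excluded,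
  excedances and anti-excedances alternate strictly inside the interval. Thus \<open>\<sigma>\<close> is a product of
  the adjacent transpositions \<open>s\<^sub>a, \<dots>, s\<^sub>b\<close> in which all indices of one parity come before all
  those of the other one. There are two such products if \<open>a < b\<close> and one if \<open>a = b\<close>, so they
  correspond to the pairs in \<open>{1..<n} \<times> {1..<n}\<close>.
\<close>

section \<open>Bipartite products of adjacent transpositions\<close>

text \<open>Parity is counted from \<open>a\<close>, so that \<open>s\<close> is the type of the
  left end of the interval.\<close>

definition rising :: "nat \<Rightarrow> bool \<Rightarrow> nat \<Rightarrow> bool" where
  "rising a s x \<longleftrightarrow> even (x + a) = s"

lemma rising_Suc [simp]: "rising a s (Suc x) \<longleftrightarrow> \<not> rising a s x"
  by (auto simp: rising_def)

lemma rising_start [simp]: "rising a s a = s"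
  by (auto simp: rising_def)

lemma rising_Not [simp]: "rising a (\<not> s) x \<longleftrightarrow> \<not> rising a s x"
  by (auto simp: rising_def)

text \<open>
  The permutation \<open>Q \<circ> P\<close>, where \<open>P\<close> is the product of the transpositions \<open>(i, i + 1)\<close> over the
  rising \<open>i \<in> {a..b}\<close> and \<open>Q\<close> the product over the other ones; swapping \<open>s\<close> swaps \<open>P\<close> and \<open>Q\<close>.
\<close>

definition zigzag :: "nat \<Rightarrow> nat \<Rightarrow> bool \<Rightarrow> nat \<Rightarrow> nat" where
  "zigzag a b s x =
     (if x < a \<or> Suc b < x then x
      else if rising a s x then (if x \<le> b then min (x + 2) (Suc b) else b)
      else (if a < x then max (x - 2) a else Suc a))"

text \<open>The inversion of \<open>zigzag a b s\<close> contributed by the factor \<open>(i, i + 1)\<close>.\<close>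

definition zigzag_edge :: "nat \<Rightarrow> nat \<Rightarrow> bool \<Rightarrow> nat \<Rightarrow> nat set" where
  "zigzag_edge a b s i =
     (if rising a s i then {i, Suc i} else {max (i - 1) a, min (i + 2) (Suc b)})"

text \<open>\<open>P\<close> and \<open>Q\<close> are involutions, so \<open>P \<circ> Q\<close>
  inverts \<open>Q \<circ> P\<close>.\<close>

lemma zigzag_inverse:
  assumes "a \<le> b"
  shows "zigzag a b (\<not> s) (zigzag a b s x) = x"
proof (cases "a + 2 \<le> x")
  case True
  then obtain y where y: "x = Suc (Suc y)" "a \<le> y" by (intro that[of "x - 2"]) auto
  consider "b < Suc y" | "b = Suc y" | "b = Suc (Suc y)" | "Suc (Suc y) < b" by linarith
  then show ?thesis using y assms by cases (cases "rising a s y"; auto simp: zigzag_def)+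
next
  case False
  then consider "x < a" | "x = a" | "x = Suc a" by linarith
  then show ?thesis using assms
    by cases (cases s; cases "b = a"; cases "b = Suc a"; auto simp: zigzag_def)+
qed

lemma zigzag_permutes:
  assumes "1 \<le> a" "a \<le> b" "b < n"
  shows "zigzag a b s permutes {1..n}"
proof (rule bij_imp_permutes)
  have inv: "zigzag a b (\<not> s) (zigzag a b s x) = x" "zigzag a b s (zigzag a b (\<not> s) x) = x" for x
    using zigzag_inverse[OF assms(2), of s x] zigzag_inverse[OF assms(2), of "\<not> s" x] by simp_all
  have "zigzag a b s x \<in> {1..n}" if "x \<in> {1..n}" for x s
    using assms that unfolding zigzag_def by auto
  then show "bij_betw (zigzag a b s) {1..n} {1..n}"
    by (intro bij_betwI[where g = "zigzag a b (\<not> s)"]) (auto simp: inv)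
  show "zigzag a b s x = x" if "x \<notin> {1..n}" for x
    using assms that by (auto simp: zigzag_def)
qed

text \<open>Each factor creates one inversion. A rising \<open>i\<close> acts first, on positions
  \<open>i\<close> and \<open>i + 1\<close>; a falling \<open>i\<close> exchanges the entries that
  \<open>P\<close> has brought to these places, from \<open>i - 1\<close> and \<open>i + 2\<close>
  unless an end of the interval intervenes.\<close>

lemma zigzag_inversions:
  assumes "a \<le> b"
  shows "{{i, j} | i j. i < j \<and> zigzag a b s j < zigzag a b s i} = zigzag_edge a b s ` {a..b}"
    (is "?L = ?R")
proof
  show "?L \<subseteq> ?R"
  proof
    fix v assume "v \<in> ?L"
    then obtain i j where v: "v = {i, j}" and ij: "i < j" "zigzag a b s j < zigzag a b s i"
      by auto
    have i: "a \<le> i" "i \<le> b" and j: "j \<le> Suc b"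
      using ij assms unfolding zigzag_def by (auto split: if_splits)
    show "v \<in> ?R"
    proof (cases "rising a s i")
      case True
      show ?thesis
      proof (cases "j = Suc i")
        case False
        \<comment> \<open>The only other inversion with left end \<open>i\<close> comes from the
          falling factor \<open>i + 1\<close>.\<close>
        consider "j = i + 2" | "i + 3 \<le> j" using False ij(1) by linarith
        then have "Suc i \<le> b \<and> j = min (i + 3) (Suc b)"
          using ij(2) True i j by cases (auto simp: zigzag_def split: if_splits)
        then show ?thesis using v True i by (intro image_eqI[of _ _ "Suc i"]) (auto simp: zigzag_edge_def)
      qed (use v True i in \<open>auto simp: zigzag_edge_def\<close>)
    next
      case False
      \<comment> \<open>A falling point other than \<open>a\<close> moves left, and everything after
        it lands further right.\<close>
      have "i = a"
        using ij False i j by (auto simp: zigzag_def split: if_splits)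
      moreover consider "j = Suc a" | "j = a + 2" | "a + 3 \<le> j" using \<open>i = a\<close> ij(1) by linarith
      then have "j = min (a + 2) (Suc b)"
        using ij False i j \<open>i = a\<close> by cases (auto simp: zigzag_def split: if_splits)
      ultimately show ?thesis using v False i by (intro image_eqI[of _ _ a]) (auto simp: zigzag_edge_def)
    qed
  qed
  show "?R \<subseteq> ?L"
  proof
    fix v assume "v \<in> ?R"
    then obtain i where i: "v = zigzag_edge a b s i" "a \<le> i" "i \<le> b" by auto
    show "v \<in> ?L"
    proof (cases "rising a s i")
      case True
      have "zigzag a b s (Suc i) < zigzag a b s i" using True i unfolding zigzag_def by auto
      then show ?thesis using True i by (auto simp: zigzag_edge_def)
    next
      case falling: False
      \<comment> \<open>The right end lands at \<open>i\<close> or below, the left end at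
        \<open>i + 1\<close> or above.\<close>
      have "zigzag a b s (min (i + 2) (Suc b)) \<le> i"
        using falling i by (cases "i = b") (auto simp: zigzag_def)
      moreover have "Suc i \<le> zigzag a b s (max (i - 1) a)"
      proof (cases "i = a")
        case False
        then obtain k where "i = Suc k" "a \<le> k" using i by (cases i) auto
        then show ?thesis using i falling by (auto simp: zigzag_def)
      qed (use falling i in \<open>auto simp: zigzag_def\<close>)
      ultimately have "zigzag a b s (min (i + 2) (Suc b)) < zigzag a b s (max (i - 1) a)" by linarith
      moreover have "max (i - 1) a < min (i + 2) (Suc b)" using i by auto
      ultimately show ?thesis using falling i(1) unfolding zigzag_edge_def by (intro CollectI exI conjI) simp_all
    qed
  qed
qed

section \<open>Intersections of the inversions of a zigzag permutation\<close>

lemma card_pair_Int_eq_1: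
  assumes "p \<noteq> q" "r \<noteq> t"
  shows "card ({p, q} \<inter> {r, t}) = 1 \<longleftrightarrow> (p = r \<or> p = t \<or> q = r \<or> q = t) \<and> {p, q} \<noteq> {r, t}"
  using assms by (cases "p = r"; cases "p = t"; cases "q = r"; cases "q = t") auto

text \<open>A rising \<open>i\<close> and a falling \<open>i + 1\<close> share the point
  \<open>i\<close>; a falling \<open>i\<close> and a rising \<open>i + 1\<close> share
  \<open>i + 2\<close>. At larger index distance the edges are disjoint.\<close>

lemma zigzag_edge_adjacent_le:
  assumes "a \<le> i" "i \<le> j" "j \<le> b"
  shows "card (zigzag_edge a b s i \<inter> zigzag_edge a b s j) = 1 \<longleftrightarrow> j = Suc i"
proof -
  define lo where "lo = (\<lambda>i. if rising a s i then i else max (i - 1) a)"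
  define hi where "hi = (\<lambda>i. if rising a s i then Suc i else min (i + 2) (Suc b))"
  have e: "zigzag_edge a b s i = {lo i, hi i}" for i
    by (auto simp: zigzag_edge_def lo_def hi_def)
  have lt: "lo i < hi i" "lo j < hi j" using assms by (auto simp: lo_def hi_def)
  have "card (zigzag_edge a b s i \<inter> zigzag_edge a b s j) = 1 \<longleftrightarrow>
      (lo i = lo j \<or> lo i = hi j \<or> hi i = lo j \<or> hi i = hi j) \<and> \<not> (lo i = lo j \<and> hi i = hi j)"
    unfolding e using lt by (subst card_pair_Int_eq_1) (auto simp: doubleton_eq_iff)
  also have "\<dots> \<longleftrightarrow> j = Suc i"
  proof -
    consider "j = i" | "j = Suc i" | "j = Suc (Suc i)" | "j \<ge> i + 3" using assms by linarith
    then show ?thesis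
    proof cases
      case 2
      then show ?thesis using assms by (cases "rising a s i") (auto simp: lo_def hi_def)
    next
      case 3
      then show ?thesis using assms by (cases "rising a s i") (auto simp: lo_def hi_def)
    next
      case 4
      \<comment> \<open>Since \<open>hi i \<le> i + 2\<close> and \<open>j - 1 \<le> lo j\<close>,
        equality would need \<open>j = i + 3\<close> with both indices falling, against
        parity.\<close>
      have "hi i \<noteq> lo j"
      proof
        assume eq: "hi i = lo j"
        then have "\<not> rising a s i" "\<not> rising a s j" "j = Suc (Suc (Suc i))"
          using assms 4 by (auto simp: lo_def hi_def split: if_splits)
        then show False by simp
      qed
      moreover have "hi i \<le> lo j" using assms 4 by (auto simp: lo_def hi_def)
      ultimately show ?thesis using lt 4 by auto
    qed auto
  qed
  finally show ?thesis .
qed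

lemma zigzag_edge_adjacent:
  assumes "i \<in> {a..b}" "j \<in> {a..b}"
  shows "card (zigzag_edge a b s i \<inter> zigzag_edge a b s j) = 1 \<longleftrightarrow> i = Suc j \<or> j = Suc i"
  using zigzag_edge_adjacent_le[of a i j b s] zigzag_edge_adjacent_le[of a j i b s] assms
  by (cases "i \<le> j") (auto simp: Int_commute)

text \<open>The least moved point is \<open>a\<close>, the greatest is \<open>b + 1\<close>, and the
  image of \<open>a\<close> reveals \<open>s\<close>. For \<open>a = b\<close> both signs give the
  same transposition, so the sign is fixed by convention there.\<close>

lemma zigzag_inj:
  assumes "a \<le> b" "a' \<le> b'" "a = b \<longrightarrow> s" "a' = b' \<longrightarrow> s'" "zigzag a b s = zigzag a' b' s'"
  shows "a = a' \<and> b = b' \<and> s = s'"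
proof -
  have mv: "zigzag a b s a > a" "zigzag a b s (Suc b) < Suc b"
    if "a \<le> b" for a b s using that by (auto simp: zigzag_def)
  have fx: "zigzag a b s x = x" if "x < a \<or> x > Suc b" for a b s x using that by (auto simp: zigzag_def)
  have a: "a = a'" using mv(1)[of a b s] mv(1)[of a' b' s'] fx[of a' a b s] fx[of a a' b' s'] assms
    by (metis linorder_neqE_nat order_less_irrefl)
  have b: "b = b'" using mv(2)[of a b s] mv(2)[of a' b' s'] fx[of "Suc b'" a b s] fx[of "Suc b" a' b' s'] assms
    by (metis Suc_less_eq linorder_neqE_nat order_less_irrefl)
  have "s = s'"
    using fun_cong[OF assms(5), of a] assms(1-4) a b by (cases s; cases s') (auto simp: zigzag_def min_def split: if_splits)
  then show ?thesis using a b by simp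
qed

section \<open>Occurrence graphs that are trees\<close>

lemma pverts_G12 [simp]: "pverts (G12 n \<pi>) = V12 n \<pi>"
  by (simp add: G12_def)

lemma parcs_G12 [simp]:
  "(u, v) \<in> parcs (G12 n \<pi>) \<longleftrightarrow> u \<in> V12 n \<pi> \<and> v \<in> V12 n \<pi> \<and> card (u \<inter> v) = 1"
  by (simp add: G12_def)

lemma connected_G12_iff:
  "Digraph_Component.connected (with_proj (G12 n \<pi>)) \<longleftrightarrow>
     V12 n \<pi> \<noteq> {} \<and> (\<forall>u \<in> V12 n \<pi>. \<forall>v \<in> V12 n \<pi>. u \<rightarrow>\<^sup>*\<^bsub>G12 n \<pi>\<^esub> v)"
proof -
  interpret pair_graph "G12 n \<pi>" by (rule pair_graph_G12)
  show ?thesis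
    by (simp add: Digraph_Component.connected_def strongly_connected_def reachable_mk_symmetric_eq[OF sym_arcs])
qed

text \<open>A walk from \<open>u\<close> to \<open>v\<close> must leave the subsets of
  \<open>S\<close>; adjacent vertices share a point, so the vertex reached at that step straddles
  \<open>S\<close>.\<close>

lemma connected_cut:
  assumes "undirected_tree (G12 n \<pi>)" "u \<in> V12 n \<pi>" "v \<in> V12 n \<pi>" "u \<subseteq> S" "v \<inter> S = {}"
  shows "\<exists>w \<in> V12 n \<pi>. w \<inter> S \<noteq> {} \<and> \<not> w \<subseteq> S"
proof (rule ccontr)
  assume *: "\<not> ?thesis"
  interpret pair_graph "G12 n \<pi>" by (rule pair_graph_G12)
  have "connected (G12 n \<pi>)" using assms(1) by (simp add: undirected_tree_def)
  then have "u \<rightarrow>\<^sup>*\<^bsub>G12 n \<pi>\<^esub> v"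
    using assms(2,3) by (simp add: connected_G12_iff)
  then have "v \<subseteq> S"
  proof (induct rule: reachable_induct)
    case (step x y)
    then have "y \<in> V12 n \<pi>" "card (x \<inter> y) = 1"
      by (auto simp: arcs_ends_conv)
    then have "x \<inter> y \<noteq> {}" by auto
    then show ?case using step * \<open>y \<in> _\<close> by auto
  qed (rule assms)
  moreover have "v \<noteq> {}" using assms(3) by (auto simp: V12_def)
  ultimately show False using assms(5) by auto
qed

lemma tree_no_triangle:
  assumes "undirected_tree (G12 n \<pi>)" "{u, v, w} \<subseteq> V12 n \<pi>"
    "card (u \<inter> v) = 1" "card (v \<inter> w) = 1" "card (w \<inter> u) = 1"
    "u \<noteq> v" "v \<noteq> w" "w \<noteq> u"
  shows False
proof -
  interpret pair_graph "G12 n \<pi>" by (rule pair_graph_G12)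
  have "undirected_cycle (G12 n \<pi>) [(u, v), (v, w), (w, u)]"
    using assms(2-) unfolding undirected_cycle_def cycle_def
    by (intro conjI exI[of _ u]) (auto simp: awalk_simps)
  then show False using assms(1) by (auto simp: undirected_tree_def)
qed

lemma tree_no_square:
  assumes "undirected_tree (G12 n \<pi>)" "{u, v, w, x} \<subseteq> V12 n \<pi>"
    "card (u \<inter> v) = 1" "card (v \<inter> w) = 1" "card (w \<inter> x) = 1" "card (x \<inter> u) = 1"
    "u \<noteq> v" "u \<noteq> w" "u \<noteq> x" "v \<noteq> w" "v \<noteq> x" "w \<noteq> x"
  shows False
proof -
  interpret pair_graph "G12 n \<pi>" by (rule pair_graph_G12)
  have "undirected_cycle (G12 n \<pi>) [(u, v), (v, w), (w, x), (x, u)]"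
    using assms(2-) unfolding undirected_cycle_def cycle_def
    by (intro conjI exI[of _ u]) (auto simp: awalk_simps)
  then show False using assms(1) by (auto simp: undirected_tree_def)
qed

text \<open>Take \<open>v\<close> on the cycle with \<open>f v\<close> maximal; its predecessor and
  successor differ because the length is at least 3.\<close>

lemma (in wf_digraph) cycle_neighbours:
  assumes "cycle p" "3 \<le> length p"
  fixes f :: "'a \<Rightarrow> nat"
  shows "\<exists>u v w. u \<rightarrow>\<^bsub>G\<^esub> v \<and> v \<rightarrow>\<^bsub>G\<^esub> w \<and> u \<noteq> w \<and> f u \<le> f v \<and> f w \<le> f v"
proof -
  obtain z where p: "awalk z p z" "distinct (tl (awalk_verts z p))" "p \<noteq> []"
    using assms(1) by (auto simp: cycle_def)
  define m where "m = length p"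
  \<comment> \<open>Indices are read modulo \<open>m\<close>, so the closing arc becomes an ordinary
    step.\<close>
  define x where "x k = head G (p ! (k mod m))" for k
  have m: "m \<ge> 3" using assms m_def by auto
  have cas: "cas z p z" and arcs: "set p \<subseteq> arcs G" using p by (auto simp: awalk_def)
  have verts: "awalk_verts z p = tail G (hd p) # map (head G) p"
    using awalk_verts_conv'[OF cas] p(3) by simp
  have dist: "distinct (map (head G) p)" using p(2) verts by simp
  have verts2: "awalk_verts z p = map (tail G) p @ [head G (last p)]"
    using p(3) by (simp add: awalk_verts_conv)
  have tl: "tail G (p ! Suc k) = head G (p ! k)" if "Suc k < m" for k
  proof -
    have "(map (tail G) p @ [head G (last p)]) ! Suc k = (tail G (hd p) # map (head G) p) ! Suc k"
      using verts verts2 by simp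
    then show ?thesis using that by (simp add: nth_append m_def)
  qed
  have "awlast z p = z" using p(1) by (rule awlast_of_awalk) (auto simp: NOMATCH_def)
  moreover have "awhd z p = z" using p(1) by (rule awhd_of_awalk)
  ultimately have tl0: "tail G (p ! 0) = head G (p ! (m - 1))"
    using verts verts2 p(3) by (auto simp: hd_conv_nth last_conv_nth m_def)
  have adj: "x k \<rightarrow>\<^bsub>G\<^esub> x (Suc k)" for k
  proof -
    have k: "Suc k mod m < m" using m by auto
    have "tail G (p ! (Suc k mod m)) = x k"
    proof (cases "Suc (k mod m) = m")
      case True
      then have "Suc k mod m = 0" "k mod m = m - 1" by (auto simp: mod_Suc)
      then show ?thesis using tl0 by (simp add: x_def)
    next
      case False
      then have "Suc k mod m = Suc (k mod m)" by (simp add: mod_Suc)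
      then show ?thesis using tl[of "k mod m"] k by (simp add: x_def)
    qed
    moreover have "p ! (Suc k mod m) \<in> arcs G" using k arcs by (auto simp: m_def)
    ultimately show ?thesis unfolding x_def by (auto simp: arcs_ends_def arc_to_ends_def intro!: image_eqI)
  qed
  have "finite (f ` x ` {..<m})" "f ` x ` {..<m} \<noteq> {}" using m by (auto simp: lessThan_empty_iff)
  then obtain j where j: "j < m" "f (x j) = Max (f ` x ` {..<m})"
    using Max_in[of "f ` x ` {..<m}"] by (smt (verit) imageE lessThan_iff)
  have max: "f (x k) \<le> f (x j)" for k
  proof -
    have "x k = x (k mod m)" by (simp add: x_def)
    moreover have "k mod m < m" using m by auto
    ultimately have "f (x k) \<in> f ` x ` {..<m}" by auto
    then show ?thesis using j by simp
  qed
  \<comment> \<open>The index \<open>j + m - 1\<close> stands for the predecessor of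
    \<open>j\<close>, avoiding truncated subtraction at \<open>j = 0\<close>.\<close>
  have xj: "x (Suc (j + m - 1)) = x j" using m by (simp add: x_def)
  have "x (j + m - 1) \<noteq> x (Suc j)"
  proof
    assume "x (j + m - 1) = x (Suc j)"
    then have "(j + m - 1) mod m = Suc j mod m"
      using dist m by (auto simp: x_def distinct_conv_nth m_def)
        (metis (no_types, lifting) mod_less_divisor gr_zeroI list.size(3) nth_map p(3) length_greater_0_conv)
    moreover have "(j + m - 1) mod m = (if j = 0 then m - 1 else j - 1)"
      using j(1) m by (auto simp: mod_if)
    moreover have "Suc j mod m = (if Suc j = m then 0 else Suc j)" using j(1) m by auto
    ultimately show False using m j by (auto split: if_splits)
  qed
  then show ?thesis using adj[of "j + m - 1"] adj[of j] max xj by metis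
qed

lemma tree_if_path:
  assumes "a \<le> b" and V: "V12 n \<pi> = e ` {a..b}"
    and adj: "\<And>i j. i \<in> {a..b} \<Longrightarrow> j \<in> {a..b} \<Longrightarrow> card (e i \<inter> e j) = 1 \<longleftrightarrow> i = Suc j \<or> j = Suc i"
  shows "undirected_tree (G12 n \<pi>)"
  unfolding undirected_tree_def
proof (intro conjI notI)
  show "pair_graph (G12 n \<pi>)" by (rule pair_graph_G12)
  interpret pair_graph "G12 n \<pi>" by (rule pair_graph_G12)
  have dom: "u \<rightarrow>\<^bsub>G12 n \<pi>\<^esub> v \<longleftrightarrow> u \<in> V12 n \<pi> \<and> v \<in> V12 n \<pi> \<and> card (u \<inter> v) = 1" for u v
    by (auto simp: arcs_ends_conv)
  have up: "e i \<rightarrow>\<^sup>*\<^bsub>G12 n \<pi>\<^esub> e j" if "i \<le> j" "a \<le> i" "j \<le> b" for i j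
    using that
  proof (induct j rule: dec_induct)
    case base
    then show ?case using V by (auto intro!: reachable_refl)
  next
    case (step k)
    have "e k \<rightarrow>\<^bsub>G12 n \<pi>\<^esub> e (Suc k)" using step adj[of k "Suc k"] V by (auto simp: dom)
    then show ?case using step by (auto intro: reachable_adj_trans)
  qed
  have "e i \<rightarrow>\<^sup>*\<^bsub>G12 n \<pi>\<^esub> e j" if "i \<in> {a..b}" "j \<in> {a..b}" for i j
    using up[of i j] up[of j i] that by (cases "i \<le> j") (auto intro: symmetric_reachable[OF sym_arcs])
  then show "connected (G12 n \<pi>)"
    using \<open>a \<le> b\<close> V by (auto simp: connected_G12_iff)
  assume "\<exists>p. undirected_cycle (G12 n \<pi>) p"
  then obtain p where p: "cycle p" "3 \<le> length p" by (auto simp: undirected_cycle_def)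
  \<comment> \<open>A vertex of maximal index on a cycle would have two distinct neighbours of smaller index.\<close>
  define idx where "idx v = (SOME i. i \<in> {a..b} \<and> e i = v)" for v
  have idx: "idx v \<in> {a..b} \<and> e (idx v) = v" if "v \<in> V12 n \<pi>" for v
    using that unfolding V idx_def by (elim imageE) (rule someI_ex, blast)
  obtain u v w where "u \<rightarrow>\<^bsub>G12 n \<pi>\<^esub> v" "v \<rightarrow>\<^bsub>G12 n \<pi>\<^esub> w" "u \<noteq> w" "idx u \<le> idx v" "idx w \<le> idx v"
    using cycle_neighbours[OF p, of idx] by auto
  \<comment> \<open>Both neighbours get the index \<open>idx v - 1\<close> and hence
    coincide.\<close>
  then show False using adj[of "idx u" "idx v"] adj[of "idx v" "idx w"] idx[of u] idx[of v] idx[of w]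
    by (auto simp: dom)
qed

section \<open>Permutations whose inversion graph is a path\<close>

text \<open>\<open>S\<close> and its preimage under \<open>\<sigma>\<close> have the same size;
  discarding their common part leaves these two sets.\<close>

lemma permutes_card_leaving_eq_entering:
  assumes "\<sigma> permutes A" "finite S"
  shows "card {i \<in> S. \<sigma> i \<notin> S} = card {j. j \<notin> S \<and> \<sigma> j \<in> S}"
proof -
  have inj: "inj \<sigma>" and surj: "surj \<sigma>"
    using assms(1) by (auto simp: permutes_inj permutes_surj)
  have fin: "finite (\<sigma> -` S)" using assms(2) inj by (simp add: finite_vimageI)
  have "card (\<sigma> -` S) = card S" using inj surj by (simp add: card_vimage_inj)
  moreover have "card (\<sigma> -` S) = card (S \<inter> \<sigma> -` S) + card {j. j \<notin> S \<and> \<sigma> j \<in> S}"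
    using fin by (subst card_Un_disjoint[symmetric]) (auto intro!: arg_cong[of _ _ card] finite_subset[OF _ fin])
  moreover have "card S = card (S \<inter> \<sigma> -` S) + card {i \<in> S. \<sigma> i \<notin> S}"
    using assms(2) by (subst card_Un_disjoint[symmetric]) (auto intro!: arg_cong[of _ _ card])
  ultimately show ?thesis by linarith
qed

lemma card_ge_2_obtain_less:
  fixes X :: "nat set"
  assumes "2 \<le> card X"
  obtains i j where "i \<in> X" "j \<in> X" "i < j"
proof -
  obtain i j where "i \<in> X" "j \<in> X" "i \<noteq> j"
    using assms by (metis card_2_iff' card_le_Suc0_iff_eq card.infinite not_less_eq_eq numeral_2_eq_2 zero_le)
  then show ?thesis using that by (metis linorder_neqE_nat)
qed

text \<open>The first four forbidden configurations are those whose inversions would form a triangle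
  or a square in the line graph; \<open>connected\<close> forbids inversions on both sides of an
  uncrossed cut.\<close>

lemma zigzag_if_inversion_path:
  assumes perm: "\<sigma> permutes {1..n}"
    and no_321: "\<And>i j k. \<lbrakk>i < j; j < k; \<sigma> k < \<sigma> j; \<sigma> j < \<sigma> i\<rbrakk> \<Longrightarrow> False"
    and no_square: "\<And>i i' j j'. \<lbrakk>i < i'; i' < j; j < j'; max (\<sigma> j) (\<sigma> j') < min (\<sigma> i) (\<sigma> i')\<rbrakk> \<Longrightarrow> False"
    and no_left_claw: "\<And>h i j k. \<lbrakk>h < i; i < j; j < k; \<sigma> k < min (\<sigma> h) (min (\<sigma> i) (\<sigma> j))\<rbrakk> \<Longrightarrow> False"
    and no_right_claw: "\<And>h i j k. \<lbrakk>h < i; i < j; j < k; max (\<sigma> i) (max (\<sigma> j) (\<sigma> k)) < \<sigma> h\<rbrakk> \<Longrightarrow> False"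
    and connected: "\<And>c h i j k. \<lbrakk>\<forall>x \<le> c. \<sigma> x \<le> c; h < i; \<sigma> i < \<sigma> h; i \<le> c; c < j; j < k; \<sigma> k < \<sigma> j\<rbrakk> \<Longrightarrow> False"
    and nontrivial: "\<sigma> \<noteq> id"
  shows "\<exists>a b s. 1 \<le> a \<and> a \<le> b \<and> b < n \<and> (a = b \<longrightarrow> s) \<and> \<sigma> = zigzag a b s"
proof -
  have inj: "\<sigma> x = \<sigma> y \<longleftrightarrow> x = y" for x y
    using permutes_inj[OF perm] by (auto dest: injD)
  have out: "\<sigma> x = x" if "x < 1 \<or> n < x" for x using perm that by (auto simp: permutes_def)
  have out_le: "\<sigma> x \<le> n" if "x \<le> n" for x
    using permutes_in_image[OF perm, of x] out[of x] that by (cases "x < 1") auto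
  \<comment> \<open>\<open>U c\<close> and \<open>D c\<close> hold the points crossing the cut
    between \<open>c\<close> and \<open>c + 1\<close> upwards and downwards; \<open>C\<close> below
    is the set of crossed cuts.\<close>
  define U where "U c = {i \<in> {..c}. \<sigma> i \<notin> {..c}}" for c
  define D where "D c = {j. j \<notin> {..c} \<and> \<sigma> j \<in> {..c}}" for c
  have inU: "i \<in> U c \<longleftrightarrow> i \<le> c \<and> c < \<sigma> i" and inD: "i \<in> D c \<longleftrightarrow> c < i \<and> \<sigma> i \<le> c" for i c
    by (auto simp: U_def D_def)
  have UD: "card (U c) = card (D c)" for c
    unfolding U_def D_def by (rule permutes_card_leaving_eq_entering[OF perm]) simp
  have finU: "finite (U c)" for c by (auto simp: U_def)
  have finD: "finite (D c)" for c
    by (rule finite_subset[of _ "\<sigma> -` {..c}"]) (auto simp: D_def intro: finite_vimageI permutes_inj[OF perm])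
  \<comment> \<open>Every upward crosser is inverted with every downward one, so two of each would
    give a square.\<close>
  have card: "card (U c) \<le> 1" for c
  proof (rule ccontr)
    assume "\<not> ?thesis"
    then have "2 \<le> card (U c)" by simp
    moreover from this have "2 \<le> card (D c)" using UD by simp
    ultimately obtain i i' j j' where *: "i \<in> U c" "i' \<in> U c" "i < i'" "j \<in> D c" "j' \<in> D c" "j < j'"
      by (metis card_ge_2_obtain_less)
    then show False using no_square[of i i' j j'] by (auto simp: inU inD)
  qed
  have Uuniq: "i = i'" if "i \<in> U c" "i' \<in> U c" for i i' c
    using card[of c] that finU by (simp add: card_le_Suc0_iff_eq)
  have Duniq: "i = i'" if "i \<in> D c" "i' \<in> D c" for i i' c
    using card[of c] that finD by (simp add: UD card_le_Suc0_iff_eq)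
  have Dempty: "D c = {} \<longleftrightarrow> U c = {}" for c
    using UD[of c] finU finD by (metis card_0_eq)
  define C where "C = {c. U c \<noteq> {}}"
  have CI: "c \<in> C" if "i \<in> U c \<or> i \<in> D c" for c i using that Dempty[of c] by (auto simp: C_def)
  have CU: "\<exists>i. i \<in> U c" and CD: "\<exists>i. i \<in> D c" if "c \<in> C" for c
    using that Dempty[of c] by (auto simp: C_def)
  have C_sub: "C \<subseteq> {1..<n}"
  proof
    fix c assume "c \<in> C"
    then obtain i where "i \<le> c" "c < \<sigma> i" using CU inU by blast
    then show "c \<in> {1..<n}" using out[of i] out_le[of i] by (cases "i < 1 \<or> n < i") auto
  qed
  \<comment> \<open>The point \<open>x\<close> lies between the cuts \<open>x - 1\<close> and
    \<open>x\<close>; the guard is there because no cut lies below \<open>0\<close>.\<close>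
  have fixed: "\<sigma> x = x" if "x \<notin> C" "x \<noteq> 0 \<Longrightarrow> x - 1 \<notin> C" for x
  proof (rule ccontr)
    assume "\<sigma> x \<noteq> x"
    then consider "x < \<sigma> x" | "\<sigma> x < x" by linarith
    then show False
    proof cases
      case 1
      then show False using that(1) CI[of x x] by (auto simp: inU)
    next
      case 2
      then have "x \<in> D (x - 1)" by (auto simp: inD)
      then show False using that(2) 2 CI[of x "x - 1"] by auto
    qed
  qed
  have "C \<noteq> {}" using fixed nontrivial by fastforce
  have "finite C" using C_sub finite_subset by blast
  define a where "a = Min C"
  define b where "b = Max C"
  have aC: "a \<in> C" and bC: "b \<in> C" using \<open>finite C\<close> \<open>C \<noteq> {}\<close> by (auto simp: a_def b_def)
  have Cab: "a \<le> c" "c \<le> b" if "c \<in> C" for c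
    using that \<open>finite C\<close> by (auto simp: a_def b_def)
  have ab: "1 \<le> a" "a \<le> b" "b < n" using aC bC C_sub Cab by auto
  have C: "c \<in> C \<longleftrightarrow> a \<le> c \<and> c \<le> b" for c
  proof
    assume c: "a \<le> c \<and> c \<le> b"
    show "c \<in> C"
    proof (rule ccontr)
      \<comment> \<open>An uncrossed \<open>c\<close> would separate the inversion formed by the
        crossers of \<open>a\<close> from the one formed by the crossers of
        \<open>b\<close>.\<close>
      assume nC: "c \<notin> C"
      obtain u d where ud: "u \<in> U a" "d \<in> D a" using CU CD aC by blast
      obtain u' d' where ud': "u' \<in> U b" "d' \<in> D b" using CU CD bC by blast
      have le: "\<forall>x \<le> c. \<sigma> x \<le> c" using CI[of _ c] nC by (meson inU not_le)
      have "d \<le> c" by (rule ccontr) (use CI[of d c] nC ud c in \<open>auto simp: inD\<close>)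
      moreover have "c < u'" using le ud' c inU by (meson le_less_trans not_le)
      ultimately show False using connected[of c u d u' d'] le ud ud' by (auto simp: inU inD)
    qed
  qed (use Cab in auto)
  have outside: "\<sigma> x = x" if "x < a \<or> Suc b < x" for x
    by (rule fixed) (use that in \<open>auto simp: C\<close>)
  \<comment> \<open>Cut \<open>a - 1\<close> is uncrossed, so the upward crosser of cut
    \<open>a\<close> is \<open>a\<close> itself; symmetrically for \<open>b + 1\<close>
    below.\<close>
  have rise_a: "a < \<sigma> a"
  proof -
    obtain u where u: "u \<le> a" "a < \<sigma> u" using CU[OF aC] by (auto simp: inU)
    show ?thesis
    proof (cases "u = a")
      case False
      then have "a - 1 \<in> C" by (intro CI[of u]) (use u in \<open>auto simp: inU\<close>)
      then show ?thesis using C ab(1) by auto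
    qed (use u in auto)
  qed
  have fall_b: "\<sigma> (Suc b) < Suc b"
  proof -
    obtain d where d: "b < d" "\<sigma> d \<le> b" using CD[OF bC] by (auto simp: inD)
    show ?thesis
    proof (cases "d = Suc b")
      case False
      then have "Suc b \<in> C" by (intro CI[of d]) (use d in \<open>auto simp: inD\<close>)
      then show ?thesis using C by auto
    qed (use d in auto)
  qed
  have cross: "\<exists>u d. u \<le> c \<and> c < \<sigma> u \<and> c < d \<and> \<sigma> d \<le> c" if "a \<le> c \<and> c \<le> b" for c
    using CU[of c] CD[of c] that by (simp add: C inU inD)
  \<comment> \<open>A fixed point here would be the middle of a 321 pattern formed with the two
    crossers of its cut.\<close>
  have moved: "\<sigma> c \<noteq> c" if "a < c" "c \<le> b" for c
  proof
    assume c: "\<sigma> c = c"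
    obtain u d where ud: "u \<le> c" "c < \<sigma> u" "c < d" "\<sigma> d \<le> c"
      using cross[of c] \<open>a < c\<close> \<open>c \<le> b\<close> less_imp_le by blast
    then have "u \<noteq> c" "\<sigma> d \<noteq> c" using c inj[of d c] by auto
    then show False using no_321[of u c d] ud c by auto
  qed
  have up_le: "\<sigma> i \<le> Suc b" if "i < \<sigma> i" for i
  proof -
    have "\<sigma> i - 1 \<in> C" by (intro CI[of i]) (use that in \<open>auto simp: inU\<close>)
    then show ?thesis by (auto simp: C)
  qed
  have down_ge: "a \<le> \<sigma> j" if "\<sigma> j < j" for j
  proof -
    have "\<sigma> j \<in> C" by (intro CI[of j]) (use that in \<open>auto simp: inD\<close>)
    then show ?thesis by (auto simp: C)
  qed
  \<comment> \<open>If \<open>z = \<sigma> i\<close> did not rise, the upward crosser of cut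
    \<open>z\<close> would start before \<open>z\<close> and so also cross cut \<open>z - 1\<close>,
    as \<open>i\<close> does. Uniqueness makes it \<open>i\<close>, which stops at
    \<open>z\<close>.\<close>
  have up_next: "\<sigma> i < \<sigma> (\<sigma> i)" if "i < \<sigma> i" "a \<le> i" "\<sigma> i \<le> b" for i
  proof (rule ccontr)
    define z where "z = \<sigma> i"
    assume "\<not> ?thesis"
    then have z: "\<sigma> z \<le> z" by (simp add: z_def)
    have "a \<le> z \<and> z \<le> b" using that by (simp add: z_def)
    from cross[OF this] obtain u where u: "u \<le> z" "z < \<sigma> u" by blast
    then have "u \<noteq> z" using z by auto
    then have "u \<in> U (z - 1)" "i \<in> U (z - 1)" using u that by (auto simp: inU z_def)
    then have "u = i" by (rule Uuniq)
    then show False using u by (simp add: z_def)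
  qed
  \<comment> \<open>A rising point cannot jump over another one, as both would cross cut
    \<open>c\<close>.\<close>
  have up_gap: "\<sigma> i \<le> c" if "i < c" "c < \<sigma> c" for i c
    using Uuniq[of i c c] that by (force simp: inU)
  have down_next: "\<sigma> (\<sigma> j) < \<sigma> j" if "\<sigma> j < j" "j \<le> Suc b" "a < \<sigma> j" for j
  proof (rule ccontr)
    define w where "w = \<sigma> j"
    assume "\<not> ?thesis"
    then have w: "w \<le> \<sigma> w" by (simp add: w_def)
    have "a \<le> w - 1 \<and> w - 1 \<le> b" using that by (auto simp: w_def)
    from cross[OF this] obtain d where d: "w - 1 < d" "\<sigma> d \<le> w - 1" by blast
    then have "d \<noteq> w" using w that by (auto simp: w_def)
    then have "d \<in> D w" "j \<in> D w" using d that by (auto simp: inD w_def)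
    then have "d = j" by (rule Duniq)
    then show False using d that by (simp add: w_def)
  qed
  have down_gap: "c \<le> \<sigma> j" if "c < j" "\<sigma> c < c" for j c
    using Duniq[of j "c - 1" c] that by (force simp: inD)
  have alternate: "c < \<sigma> c \<longleftrightarrow> \<not> Suc c < \<sigma> (Suc c)" if c: "a < c" "c < b" for c
  proof (rule ccontr)
    assume "\<not> ?thesis"
    then consider "c < \<sigma> c" "Suc c < \<sigma> (Suc c)" | "\<sigma> c < c" "\<sigma> (Suc c) < Suc c"
      using moved[of c] moved[of "Suc c"] c by (metis Suc_leI less_imp_le less_SucI linorder_neqE_nat)
    then show False
    proof cases
      case 1
      \<comment> \<open>The downward crosser of cut \<open>c - 1\<close> is inverted with
        \<open>c\<close>, \<open>c + 1\<close> and the upward crosser of that cut.\<close>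
      have "a \<le> c - 1 \<and> c - 1 \<le> b" using c by auto
      from cross[OF this] obtain u d where ud: "u \<le> c - 1" "c - 1 < \<sigma> u" "c - 1 < d" "\<sigma> d \<le> c - 1"
        by blast
      then have "d \<noteq> c" "d \<noteq> Suc c" using 1 by auto
      then show False by (intro no_left_claw[of u c "Suc c" d]) (use ud 1 c in auto)
    next
      case 2
      \<comment> \<open>Dually, the upward crosser of cut \<open>c + 1\<close> is inverted with
        \<open>c\<close>, \<open>c + 1\<close> and the downward crosser.\<close>
      have "a \<le> Suc c \<and> Suc c \<le> b" using c by auto
      from cross[OF this] obtain u d where ud: "u \<le> Suc c" "Suc c < \<sigma> u" "Suc c < d" "\<sigma> d \<le> Suc c"
        by blast
      then have "u \<noteq> c" "u \<noteq> Suc c" using 2 by auto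
      then show False by (intro no_right_claw[of u c "Suc c" d]) (use ud 2 c in auto)
    qed
  qed
  \<comment> \<open>The point \<open>a\<close> rises for either sign, so the parity is read off at
    \<open>a + 1\<close>; for \<open>a = b\<close> the sign is normalised to true.\<close>
  define s where "s \<longleftrightarrow> (a = b \<or> \<sigma> (Suc a) < Suc a)"
  have type: "c < \<sigma> c \<longleftrightarrow> rising a s c" if "Suc a \<le> c" "c \<le> b" for c
    using that
  proof (induct c rule: dec_induct)
    case base
    then show ?case using moved[of "Suc a"] by (auto simp: s_def)
  next
    case (step c)
    then show ?case using alternate[of c] by auto
  qed
  have fall: "\<sigma> c < c \<longleftrightarrow> \<not> rising a s c" if "a < c" "c \<le> b" for c
    using type[of c] moved[of c] that by auto
  have "\<sigma> x = zigzag a b s x" for x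
  proof (cases "x < a \<or> Suc b < x")
    case False
    then have x: "a \<le> x" "x \<le> Suc b" by auto
    consider (up) "rising a s x" "x \<le> b" | (last) "rising a s x" "x = Suc b"
      | (down) "\<not> rising a s x" "a < x" | (first) "\<not> rising a s x" "x = a"
      using x by linarith
    then show ?thesis
    proof cases
      case up
      have r: "x < \<sigma> x" using rise_a type[of x] up x by (cases "x = a") auto
      \<comment> \<open>By alternation \<open>x + 1\<close> falls and \<open>x + 2\<close> rises
        inside the interval: \<open>x\<close> cannot land on the former or pass the latter.\<close>
      have "\<sigma> x \<noteq> Suc x" if "x < b"
        using up_next[OF r x(1)] type[of "Suc x"] that x up by auto
      moreover have "\<sigma> x \<le> x + 2" if "x + 2 \<le> b"
        using up_gap[of x "x + 2"] type[of "x + 2"] that x up by auto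
      ultimately have "\<sigma> x = min (x + 2) (Suc b)" using up_le[OF r] r up by linarith
      then show ?thesis using up x by (simp add: zigzag_def)
    next
      case last
      have "\<sigma> x = b"
        using down_ge[of x] down_gap[of b x] fall[of b] fall_b last ab by (cases "a = b") auto
      then show ?thesis using last x by (simp add: zigzag_def)
    next
      case down
      have f: "\<sigma> x < x" using fall_b fall[of x] down x by (cases "x = Suc b") auto
      obtain y where y: "x = Suc y" "a \<le> y" using down by (cases x) auto
      have "a < y \<longrightarrow> \<sigma> x \<noteq> y"
        using down_next[OF f x(2)] fall[of y] x down y by auto
      moreover have "a < y - 1 \<longrightarrow> y - 1 \<le> \<sigma> x"
        using down_gap[of "y - 1" x] fall[of "y - 1"] x down y by (cases y) auto
      ultimately have "\<sigma> x = max (x - 2) a" using down_ge[OF f] f y by (simp add: max_def) linarith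
      then show ?thesis using down x by (simp add: zigzag_def)
    next
      case first
      then have "\<not> s" by simp
      \<comment> \<open>A false \<open>s\<close> means that \<open>a < b\<close> and
        \<open>a + 1\<close> rises, so \<open>a\<close> cannot pass it.\<close>
      then have "\<sigma> a = Suc a" using up_gap[of a "Suc a"] moved[of "Suc a"] rise_a ab
        by (auto simp: s_def)
      then show ?thesis using first ab by (simp add: zigzag_def)
    qed
  qed (use outside in \<open>auto simp: zigzag_def\<close>)
  moreover have "a = b \<longrightarrow> s" by (simp add: s_def)
  ultimately show ?thesis using ab by blast
qed

section \<open>Counting\<close>

definition reversal :: "nat \<Rightarrow> nat \<Rightarrow> nat" where
  "reversal n x = (if x \<in> {1..n} then Suc n - x else x)"

lemma reversal_involution: "reversal n \<circ> reversal n = id"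
  by (rule ext) (auto simp: reversal_def)

lemma reversal_permutes: "reversal n permutes {1..n}"
proof (rule bij_imp_permutes)
  show "bij_betw (reversal n) {1..n} {1..n}"
    by (rule bij_betwI[where g = "reversal n"]) (auto simp: reversal_def)
qed (auto simp: reversal_def)

text \<open>The bounds \<open>1\<close> and \<open>n\<close> disappear because
  \<open>\<sigma>\<close> preserves \<open>{1..n}\<close> and fixes all other points, which
  therefore lie in no inversion.\<close>

lemma V12_reversal:
  assumes "\<sigma> permutes {1..n}"
  shows "V12 n (reversal n \<circ> \<sigma>) = {{i, j} | i j. i < j \<and> \<sigma> j < \<sigma> i}"
proof -
  have range: "\<sigma> x \<in> {1..n} \<longleftrightarrow> x \<in> {1..n}" for x
    using assms by (rule permutes_in_image)
  have out: "\<sigma> x = x" if "x \<notin> {1..n}" for x using assms that by (auto simp: permutes_def)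
  have "1 \<le> i \<and> i < j \<and> j \<le> n \<and> (reversal n \<circ> \<sigma>) i < (reversal n \<circ> \<sigma>) j \<longleftrightarrow> i < j \<and> \<sigma> j < \<sigma> i" for i j
  proof (cases "i \<in> {1..n} \<and> j \<in> {1..n}")
    case True
    then show ?thesis using range[of i] range[of j] by (auto simp: reversal_def)
  next
    case False
    then show ?thesis using range[of i] range[of j] out[of i] out[of j] by (auto simp: not_le)
  qed
  then show ?thesis by (simp add: V12_def)
qed

lemma zigzag_if_tree:
  assumes perm: "\<sigma> permutes {1..n}" and tree: "undirected_tree (G12 n (reversal n \<circ> \<sigma>))"
  shows "\<exists>a b s. 1 \<le> a \<and> a \<le> b \<and> b < n \<and> (a = b \<longrightarrow> s) \<and> \<sigma> = zigzag a b s"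
proof (rule zigzag_if_inversion_path[OF perm])
  let ?V = "V12 n (reversal n \<circ> \<sigma>)"
  have V: "?V = {{i, j} | i j. i < j \<and> \<sigma> j < \<sigma> i}" using perm by (rule V12_reversal)
  have edge: "{i, j} \<in> ?V" if "i < j" "\<sigma> j < \<sigma> i" for i j using that V by auto
  show False if "i < j" "j < k" "\<sigma> k < \<sigma> j" "\<sigma> j < \<sigma> i" for i j k
    by (rule tree_no_triangle[OF tree, of "{i, j}" "{j, k}" "{i, k}"])
      (use that edge in \<open>auto simp: card_pair_Int_eq_1[unfolded One_nat_def] doubleton_eq_iff\<close>)
  show False if "i < i'" "i' < j" "j < j'" "max (\<sigma> j) (\<sigma> j') < min (\<sigma> i) (\<sigma> i')" for i i' j j'
    by (rule tree_no_square[OF tree, of "{i, j}" "{i', j}" "{i', j'}" "{i, j'}"])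
      (use that edge in \<open>auto simp: card_pair_Int_eq_1[unfolded One_nat_def] doubleton_eq_iff\<close>)
  show False if "h < i" "i < j" "j < k" "\<sigma> k < min (\<sigma> h) (min (\<sigma> i) (\<sigma> j))" for h i j k
    by (rule tree_no_triangle[OF tree, of "{h, k}" "{i, k}" "{j, k}"])
      (use that edge in \<open>auto simp: card_pair_Int_eq_1[unfolded One_nat_def] doubleton_eq_iff\<close>)
  show False if "h < i" "i < j" "j < k" "max (\<sigma> i) (max (\<sigma> j) (\<sigma> k)) < \<sigma> h" for h i j k
    by (rule tree_no_triangle[OF tree, of "{h, i}" "{h, j}" "{h, k}"])
      (use that edge in \<open>auto simp: card_pair_Int_eq_1[unfolded One_nat_def] doubleton_eq_iff\<close>)
  show False if cut: "\<forall>x \<le> c. \<sigma> x \<le> c" and "h < i" "\<sigma> i < \<sigma> h" "i \<le> c" "c < j" "j < k" "\<sigma> k < \<sigma> j"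
    for c h i j k
  proof -
    \<comment> \<open>No point leaves \<open>{..c}\<close>, so by counting none enters it.\<close>
    have "card {j. j \<notin> {..c} \<and> \<sigma> j \<in> {..c}} = card {i \<in> {..c}. \<sigma> i \<notin> {..c}}"
      using permutes_card_leaving_eq_entering[OF perm, of "{..c}"] by simp
    also have "{i \<in> {..c}. \<sigma> i \<notin> {..c}} = {}" using cut by auto
    finally have "card {j. j \<notin> {..c} \<and> \<sigma> j \<in> {..c}} = 0" by simp
    moreover have "finite {j. j \<notin> {..c} \<and> \<sigma> j \<in> {..c}}"
      by (rule finite_subset[of _ "\<sigma> -` {..c}"]) (auto intro: finite_vimageI permutes_inj[OF perm])
    ultimately have stay: "c < \<sigma> j" if "c < j" for j using that by (auto simp: not_le)
    \<comment> \<open>Connectedness supplies an inversion straddling the cut, but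
      \<open>\<sigma>\<close> keeps each of its two points on its own side.\<close>
    have "\<exists>w \<in> ?V. w \<inter> {..c} \<noteq> {} \<and> \<not> w \<subseteq> {..c}"
      by (rule connected_cut[OF tree, of "{h, i}" "{j, k}"]) (use that edge in auto)
    then obtain x y where "x < y" "\<sigma> y < \<sigma> x" "x \<le> c" "c < y" using V by force
    then show False using cut stay by (meson less_trans not_le)
  qed
  show "\<sigma> \<noteq> id"
  proof
    assume "\<sigma> = id"
    then have "?V = {}" using V by auto
    then show False using tree by (simp add: undirected_tree_def connected_G12_iff)
  qed
qed

lemma tree_zigzag:
  assumes "1 \<le> a" "a \<le> b" "b < n"
  shows "undirected_tree (G12 n (reversal n \<circ> zigzag a b s))"
proof (rule tree_if_path[OF assms(2)])
  show "V12 n (reversal n \<circ> zigzag a b s) = zigzag_edge a b s ` {a..b}"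
    using V12_reversal[OF zigzag_permutes[OF assms]] zigzag_inversions[OF assms(2)] by simp
qed (rule zigzag_edge_adjacent)

theorem theorem6p3:
  fixes n :: nat
  assumes "n \<ge> 1"
  shows "card {\<pi>. \<pi> permutes {1..n} \<and> undirected_tree (G12 n \<pi>)} = (n - 1)\<^sup>2"
proof -
  \<comment> \<open>The unordered pair gives the interval and the order of its entries the sign; the
    diagonal gives the single permutation for \<open>a = b\<close>.\<close>
  define P where "P = (\<lambda>(p, q). reversal n \<circ> zigzag (min p q) (max p q) (p \<le> q))"
  have rev: "reversal n \<circ> (reversal n \<circ> \<sigma>) = \<sigma>" for \<sigma>
    by (simp add: o_assoc reversal_involution)
  have "{\<pi>. \<pi> permutes {1..n} \<and> undirected_tree (G12 n \<pi>)} = P ` ({1..<n} \<times> {1..<n})"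
  proof (intro equalityI subsetI)
    fix \<pi> assume \<pi>: "\<pi> \<in> {\<pi>. \<pi> permutes {1..n} \<and> undirected_tree (G12 n \<pi>)}"
    have "\<exists>a b s. 1 \<le> a \<and> a \<le> b \<and> b < n \<and> (a = b \<longrightarrow> s) \<and> reversal n \<circ> \<pi> = zigzag a b s"
      using \<pi> by (intro zigzag_if_tree) (simp_all add: rev permutes_compose[OF _ reversal_permutes] del: One_nat_def)
    then obtain a b s where z: "1 \<le> a" "a \<le> b" "b < n" "a = b \<longrightarrow> s" "reversal n \<circ> \<pi> = zigzag a b s"
      by blast
    \<comment> \<open>A false \<open>s\<close> forces \<open>a < b\<close>, so the pair
      \<open>(b, a)\<close> is strictly decreasing and encodes that sign.\<close>
    then have "\<pi> = P (if s then (a, b) else (b, a))"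
      using rev[of \<pi>] by (auto simp: P_def min_def max_def)
    then show "\<pi> \<in> P ` ({1..<n} \<times> {1..<n})" using z by auto
  next
    fix \<pi> assume "\<pi> \<in> P ` ({1..<n} \<times> {1..<n})"
    then obtain p q where pq: "p \<in> {1..<n}" "q \<in> {1..<n}" "\<pi> = P (p, q)" by auto
    then have "1 \<le> min p q" "min p q \<le> max p q" "max p q < n" by auto
    from tree_zigzag[OF this] zigzag_permutes[OF this]
    show "\<pi> \<in> {\<pi>. \<pi> permutes {1..n} \<and> undirected_tree (G12 n \<pi>)}"
      using pq(3) by (simp add: P_def permutes_compose[OF _ reversal_permutes] del: One_nat_def)
  qed
  moreover have "inj_on P ({1..<n} \<times> {1..<n})"
  proof (rule inj_onI, clarify)
    fix p q p' q' assume "P (p, q) = P (p', q')"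
    then have "reversal n \<circ> P (p, q) = reversal n \<circ> P (p', q')" by simp
    then have "zigzag (min p q) (max p q) (p \<le> q) = zigzag (min p' q') (max p' q') (p' \<le> q')"
      by (simp add: P_def rev)
    then have "min p q = min p' q' \<and> max p q = max p' q' \<and> (p \<le> q) = (p' \<le> q')"
      by (intro zigzag_inj) auto
    then show "p = p' \<and> q = q'" by (auto simp: min_def max_def split: if_splits)
  qed
  ultimately show ?thesis by (simp add: card_image power2_eq_square)
qed

end
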